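(* Suppose that $S^{\max}-S^{\min}<2\Delta<S^{\min}$. Then, adding a new cognitive type $M$ to the set of cognitive types $\mathcal{M}$ has the following effects on the unique interior equilibrium: (i) $\bar q(\theta)$ weakly decreases for every state $\theta$. (ii) $h(\theta)$ weakly increases for every state $\theta$. (iii) Social surplus weakly increases in each state. (iv) Individual consumers' net payoff weakly decreases in each state. Moreover, if $\mathcal{M}$ includes a rational type, then consumers incur an ex-ante welfare loss, which increases when $M$ is added to $\mathcal{M}$.
   Context: Primitives: $\Theta=\Theta_1\times\cdots\times\Theta_n$ is a finite set of states; $\mu$ is a full-support probability distribution on $\Theta$; $S:\Theta\to(0,\infty)$ is one-to-one; $S^{\max}=\max_\theta S(\theta)$, $S^{\min}=\min_\theta S(\theta)$; $v^*$ (the consumers' bare valuation of the product) and $c$ (a firm's cost) are real numbers with $\Delta=v^*-c>0$. The set of consumers' cognitive types $\mathcal{M}$ is a finite nonempty collection of distinct subsets of $\{1,\dots,n\}$; there is a measure greater than one of consumers of each type. The rational type is $\{1,\dots,n\}$. A new type is a subset $M\subseteq\{1,\dots,n\}$ with $M\notin\mathcal{M}$. For $M\subseteq\{1,\dots,n\}$ write $\theta_M=(\theta_i)_{i\in M}$, and let $\mu(\theta'\mid\theta'_M=\theta_M)$ be $\mu(\theta')/\sum_{\theta'':\theta''_M=\theta_M}\mu(\theta'')$ if $\theta'_M=\theta_M$, and $0$ otherwise. Firms: there is a measure one of firms, with types $\pi\sim U[0,1]$. A type-$\pi$ firm is active at state $\theta$ and price $\phi$ iff $\phi-c+\pi S(\theta)\ge0$.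 When a consumer buys from it, he pays it the price $\phi$ and in addition a hidden add-on transfer $\pi S(\theta)$. Let $\pi^\star(\theta,\phi)=(c-\phi)/S(\theta)$ be the marginal type. For a price function $h:\Theta\to\mathbb{R}$, the volume of trade in state $\theta$ is $1-\pi^\star(\theta,h(\theta))$, and the expected add-on among active firms in state $\theta$ is $\bar q(\theta)=\frac{1+\pi^\star(\theta,h(\theta))}{2}S(\theta)$. Payoffs: a consumer who buys in state $\theta$ at price $h(\theta)$ from a type-$\pi$ firm has net payoff $v^*-h(\theta)-\pi S(\theta)$; a consumer who does not buy has net payoff $0$. Each trade generates social surplus $\Delta$ (the price and the add-on being pure transfers). "Ex-ante" means before the state $\theta\sim\mu$ is realized. Equilibrium (homogeneous-preference limit, in which all consumers' bare valuation is $v^*$ and equilibrium prices are fully revealing of the state): given $\mathcal{M}$, $h:\Theta\to\mathbb{R}$ is an interior equilibrium if for every $\theta$, $\pi^\star(\theta,h(\theta))\in(0,1)$ and $$h(\theta)=v^*-\min_{M\in\mathcal{M}}\sum_{\theta'}\mu(\theta'\mid\theta'_M=\theta_M)\,\bar q(\theta').$$ That is, the price equals the highest net willingness to pay among the cognitive types, and the types that trade in $\theta$ are those attaining the minimum. Under $S^{\max}-S^{\min}<2\Delta<S^{\min}$ an interior equilibrium exists and is unique for every such $\mathcal{M}$. *)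

theory Defs
  imports "HOL-Probability.Probability_Mass_Function"
begin

text \<open>
  A state assigns to each index in {1..n} a component from the finite set T i. A cognitive type is
  the set of indices of the components that the consumer conditions on.
\<close>

definition states :: "nat \<Rightarrow> (nat \<Rightarrow> 'a set) \<Rightarrow> (nat \<Rightarrow> 'a) set" where
  "states n T = PiE {1..n} T"

definition agree_on :: "nat set \<Rightarrow> (nat \<Rightarrow> 'a) \<Rightarrow> (nat \<Rightarrow> 'a) \<Rightarrow> bool" where
  "agree_on M \<theta> \<theta>' \<longleftrightarrow> (\<forall>i\<in>M. \<theta>' i = \<theta> i)"

definition cond_prob ::
  "(nat \<Rightarrow> 'a) set \<Rightarrow> (nat \<Rightarrow> 'a) pmf \<Rightarrow> nat set \<Rightarrow> (nat \<Rightarrow> 'a) \<Rightarrow> (nat \<Rightarrow> 'a) \<Rightarrow> real" where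
  "cond_prob \<Theta> \<mu> M \<theta> \<theta>' =
     (if agree_on M \<theta> \<theta>' then pmf \<mu> \<theta>' / (\<Sum>\<theta>''\<in>{\<theta>''\<in>\<Theta>. agree_on M \<theta> \<theta>''}. pmf \<mu> \<theta>'') else 0)"

text \<open>
  A firm of type \<open>\<pi>\<close>, uniformly distributed on [0,1], is active at price \<open>\<phi>\<close> iff
  \<open>\<phi> - c + \<pi> * S \<theta> \<ge> 0\<close>, i.e. iff \<open>\<pi>\<close> is at least the marginal type. Hence, for a marginal type in
  (0,1), the active types are those between it and 1, which gives the volume of trade and the
  expected add-on below.
\<close>

definition marginal_type :: "('s \<Rightarrow> real) \<Rightarrow> real \<Rightarrow> 's \<Rightarrow> real \<Rightarrow> real" where
  "marginal_type S c \<theta> \<phi> = (c - \<phi>) / S \<theta>"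

definition trade_volume :: "('s \<Rightarrow> real) \<Rightarrow> real \<Rightarrow> ('s \<Rightarrow> real) \<Rightarrow> 's \<Rightarrow> real" where
  "trade_volume S c h \<theta> = 1 - marginal_type S c \<theta> (h \<theta>)"

definition expected_add_on :: "('s \<Rightarrow> real) \<Rightarrow> real \<Rightarrow> ('s \<Rightarrow> real) \<Rightarrow> 's \<Rightarrow> real" where
  "expected_add_on S c h \<theta> = (1 + marginal_type S c \<theta> (h \<theta>)) / 2 * S \<theta>"

definition interior_equilibrium ::
  "(nat \<Rightarrow> 'a) set \<Rightarrow> (nat \<Rightarrow> 'a) pmf \<Rightarrow> ((nat \<Rightarrow> 'a) \<Rightarrow> real) \<Rightarrow> real \<Rightarrow> real \<Rightarrow> nat set set \<Rightarrow>
   ((nat \<Rightarrow> 'a) \<Rightarrow> real) \<Rightarrow> bool" where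
  "interior_equilibrium \<Theta> \<mu> S v c \<M> h \<longleftrightarrow>
     (\<forall>\<theta>\<in>\<Theta>. 0 < marginal_type S c \<theta> (h \<theta>) \<and> marginal_type S c \<theta> (h \<theta>) < 1 \<and>
        h \<theta> = v - Min ((\<lambda>M. \<Sum>\<theta>'\<in>\<Theta>. cond_prob \<Theta> \<mu> M \<theta> \<theta>' * expected_add_on S c h \<theta>') ` \<M>))"

definition social_surplus :: "('s \<Rightarrow> real) \<Rightarrow> real \<Rightarrow> real \<Rightarrow> ('s \<Rightarrow> real) \<Rightarrow> 's \<Rightarrow> real" where
  "social_surplus S v c h \<theta> = (v - c) * trade_volume S c h \<theta>"

definition buyer_payoff :: "('s \<Rightarrow> real) \<Rightarrow> real \<Rightarrow> ('s \<Rightarrow> real) \<Rightarrow> 's \<Rightarrow> real \<Rightarrow> real" where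
  "buyer_payoff S v h \<theta> \<pi> = v - h \<theta> - \<pi> * S \<theta>"

text \<open>The expectation of \<open>buyer_payoff\<close> over the types of the active firms:\<close>

definition expected_buyer_payoff ::
  "('s \<Rightarrow> real) \<Rightarrow> real \<Rightarrow> real \<Rightarrow> ('s \<Rightarrow> real) \<Rightarrow> 's \<Rightarrow> real" where
  "expected_buyer_payoff S v c h \<theta> = v - h \<theta> - expected_add_on S c h \<theta>"

text \<open>
  Consumers who do not buy have net payoff 0, so aggregate consumer welfare in a state is the volume
  of trade times the expected net payoff of a buyer; the loss is its negated expectation.
\<close>

definition ex_ante_consumer_loss ::
  "'s set \<Rightarrow> 's pmf \<Rightarrow> ('s \<Rightarrow> real) \<Rightarrow> real \<Rightarrow> real \<Rightarrow> ('s \<Rightarrow> real) \<Rightarrow> real" where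
  "ex_ante_consumer_loss \<Theta> \<mu> S v c h =
     - (\<Sum>\<theta>\<in>\<Theta>. pmf \<mu> \<theta> * (trade_volume S c h \<theta> * expected_buyer_payoff S v c h \<theta>))"

end

theory Submission
  imports Defs
begin

text \<open>
  In equilibrium the expected add-on $q$ is a fixed point of
  $q \mapsto (S - \Delta + \min_M E_M[q]) / 2$. This operator is monotone, halves additive
  constants, and decreases when a type is added. So at a state where $q' - q$
  attains its maximum $d$ we get $d \le d/2$, i.e. $q' \le q$. Everything else is monotone in $q$:
  $h = S + c - 2q$ and a buyer's expected payoff is $\min_M E_M[q] - q$, which is nonpositive if a
  rational type is present.
\<close>

lemma finite_states: "(\<And>i. i \<in> {1..n} \<Longrightarrow> finite (T i)) \<Longrightarrow> finite (states n T)"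
  unfolding states_def by (rule finite_PiE) auto

lemma cond_prob_nonneg: "0 \<le> cond_prob \<Theta> \<mu> M \<theta> \<theta>'"
  by (simp add: cond_prob_def sum_nonneg)

lemma sum_cond_prob:
  assumes "finite \<Theta>" "set_pmf \<mu> = \<Theta>" "\<theta> \<in> \<Theta>"
  shows "(\<Sum>\<theta>'\<in>\<Theta>. cond_prob \<Theta> \<mu> M \<theta> \<theta>') = 1"
proof -
  let ?A = "{\<theta>'\<in>\<Theta>. agree_on M \<theta> \<theta>'}"
  \<comment> \<open>The state \<open>\<theta>\<close> agrees with itself and has positive mass by
    full support, so the normalising denominator does not vanish.\<close>
  have "0 < sum (pmf \<mu>) ?A"
    using assms by (intro sum_pos2[of _ \<theta>]) (auto simp: agree_on_def pmf_positive)
  moreover have "(\<Sum>\<theta>'\<in>\<Theta>. cond_prob \<Theta> \<mu> M \<theta> \<theta>') = (\<Sum>\<theta>'\<in>?A. pmf \<mu> \<theta>' / sum (pmf \<mu>) ?A)"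
    unfolding cond_prob_def sum.inter_filter[OF assms(1)] ..
  ultimately show ?thesis
    by (simp flip: sum_divide_distrib)
qed

text \<open>States are extensional functions on \<open>{1..n}\<close>, so agreement on all these
  indices already forces equality: a rational type identifies the state.\<close>

lemma cond_prob_rational:
  assumes "\<theta> \<in> states n T" "\<theta>' \<in> states n T" "\<theta>' \<noteq> \<theta>"
  shows "cond_prob \<Theta> \<mu> {1..n} \<theta> \<theta>' = 0"
proof -
  have "\<not> agree_on {1..n} \<theta> \<theta>'"
    using assms PiE_ext[of \<theta>' "{1..n}" T \<theta>] unfolding states_def agree_on_def by blast
  then show ?thesis
    by (simp add: cond_prob_def)
qed

lemma cond_expectation_rational:
  assumes "finite \<Theta>" "set_pmf \<mu> = \<Theta>" "\<Theta> = states n T" "\<theta> \<in> \<Theta>"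
  shows "(\<Sum>\<theta>'\<in>\<Theta>. cond_prob \<Theta> \<mu> {1..n} \<theta> \<theta>' * f \<theta>') = f \<theta>"
proof -
  \<comment> \<open>Kept general in \<open>g\<close>: the constant function 1 will show that the
    surviving weight \<open>cond_prob \<Theta> \<mu> {1..n} \<theta> \<theta>\<close> equals
    1.\<close>
  have "(\<Sum>\<theta>'\<in>\<Theta>. cond_prob \<Theta> \<mu> {1..n} \<theta> \<theta>' * g \<theta>') = cond_prob \<Theta> \<mu> {1..n} \<theta> \<theta> * g \<theta>"
    for g :: "_ \<Rightarrow> real"
    using assms cond_prob_rational[of \<theta> n T]
    by (subst sum.remove[of _ \<theta>]) (auto intro!: sum.neutral)
  from this[of f] this[of "\<lambda>_. 1"] show ?thesis
    using sum_cond_prob[OF assms(1,2,4)] by simp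
qed

text \<open>The three properties of the minimum that the fixed-point argument uses, in one
  inequality. A type attaining the minimum for \<open>g\<close> over \<open>\<A>\<close> still
  competes in \<open>\<B>\<close>; its weights are nonnegative, so its expectation is monotone, and
  they sum to 1, so \<open>d\<close> comes out unchanged.\<close>

lemma min_cond_expectation_le:
  assumes "finite \<Theta>" "set_pmf \<mu> = \<Theta>" "\<theta> \<in> \<Theta>"
    and "\<A> \<subseteq> \<B>" "finite \<B>" "\<A> \<noteq> {}"
    and le: "\<And>\<theta>'. \<theta>' \<in> \<Theta> \<Longrightarrow> f \<theta>' \<le> g \<theta>' + d"
  shows "Min ((\<lambda>M. \<Sum>\<theta>'\<in>\<Theta>. cond_prob \<Theta> \<mu> M \<theta> \<theta>' * f \<theta>') ` \<B>)
    \<le> Min ((\<lambda>M. \<Sum>\<theta>'\<in>\<Theta>. cond_prob \<Theta> \<mu> M \<theta> \<theta>' * g \<theta>') ` \<A>) + d"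
    (is "Min (?E f ` \<B>) \<le> Min (?E g ` \<A>) + d")
proof -
  have "finite \<A>"
    using assms finite_subset by blast
  then obtain M where M: "M \<in> \<A>" "Min (?E g ` \<A>) = ?E g M"
    using Min_in[of "?E g ` \<A>"] assms(6) by blast
  have "Min (?E f ` \<B>) \<le> ?E f M"
    using M(1) assms(4,5) by (intro Min_le) auto
  also have "\<dots> \<le> (\<Sum>\<theta>'\<in>\<Theta>. cond_prob \<Theta> \<mu> M \<theta> \<theta>' * (g \<theta>' + d))"
    by (intro sum_mono mult_left_mono le cond_prob_nonneg)
  also have "\<dots> = ?E g M + d"
    using sum_cond_prob[OF assms(1-3)]
    by (simp add: distrib_left sum.distrib flip: sum_distrib_right)
  finally show ?thesis
    using M(2) by simp
qed

text \<open>The add-on is affine in the price with slope -1/2: a higher price draws in firms with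
  smaller add-ons. This slope is what makes the equilibrium operator halve constants.\<close>

lemma expected_add_on_eq: "S \<theta> > 0 \<Longrightarrow> expected_add_on S c h \<theta> = (S \<theta> + c - h \<theta>) / 2"
  by (simp add: expected_add_on_def marginal_type_def field_simps)

lemma interior_equilibrium_price:
  assumes "interior_equilibrium \<Theta> \<mu> S v c \<M> h" "\<theta> \<in> \<Theta>"
  shows "h \<theta> = v - Min ((\<lambda>M. \<Sum>\<theta>'\<in>\<Theta>. cond_prob \<Theta> \<mu> M \<theta> \<theta>' * expected_add_on S c h \<theta>') ` \<M>)"
  using assms unfolding interior_equilibrium_def by blast

lemma interior_equilibrium_trade_volume_pos:
  "interior_equilibrium \<Theta> \<mu> S v c \<M> h \<Longrightarrow> \<theta> \<in> \<Theta> \<Longrightarrow> 0 < trade_volume S c h \<theta>"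
  unfolding interior_equilibrium_def trade_volume_def diff_gt_0_iff_gt by blast

lemma expected_add_on_antimono:
  assumes fin: "finite \<Theta>" and supp: "set_pmf \<mu> = \<Theta>"
    and pos: "\<And>\<theta>. \<theta> \<in> \<Theta> \<Longrightarrow> S \<theta> > 0"
    and sub: "\<A> \<subseteq> \<B>" "finite \<B>" "\<A> \<noteq> {}"
    and h: "interior_equilibrium \<Theta> \<mu> S v c \<A> h"
    and h': "interior_equilibrium \<Theta> \<mu> S v c \<B> h'"
    and "\<theta> \<in> \<Theta>"
  shows "expected_add_on S c h' \<theta> \<le> expected_add_on S c h \<theta>"
proof -
  let ?q = "expected_add_on S c h" and ?q' = "expected_add_on S c h'"
  \<comment> \<open>The sign of \<open>d\<close> is still open; the goal is to show
    \<open>d \<le> 0\<close>.\<close>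
  define d where "d = Max ((\<lambda>\<theta>. ?q' \<theta> - ?q \<theta>) ` \<Theta>)"
  have d: "?q' \<theta>' \<le> ?q \<theta>' + d" if "\<theta>' \<in> \<Theta>" for \<theta>'
  proof -
    have "?q' \<theta>' - ?q \<theta>' \<le> d"
      unfolding d_def using fin that by (intro Max_ge) auto
    then show ?thesis
      by simp
  qed
  have "d \<in> (\<lambda>\<theta>. ?q' \<theta> - ?q \<theta>) ` \<Theta>"
    unfolding d_def using fin \<open>\<theta> \<in> \<Theta>\<close> by (intro Max_in) auto
  then obtain \<theta>0 where \<theta>0: "\<theta>0 \<in> \<Theta>" "d = ?q' \<theta>0 - ?q \<theta>0"
    by blast
  \<comment> \<open>Each price is \<open>v\<close> minus a minimum, so this price difference is the
    minimum over \<open>\<B>\<close> for \<open>?q'\<close> less the minimum over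
    \<open>\<A>\<close> for \<open>?q\<close>.\<close>
  have "h \<theta>0 - h' \<theta>0 \<le> d"
    using min_cond_expectation_le[where f = ?q' and g = ?q, OF fin supp \<theta>0(1) sub d]
    unfolding interior_equilibrium_price[OF h \<theta>0(1)] interior_equilibrium_price[OF h' \<theta>0(1)]
    by simp
  \<comment> \<open>By the slope -1/2, a gap \<open>d\<close> in add-ons at \<open>\<theta>0\<close>
    needs a price gap twice as large, and \<open>2 * d \<le> d\<close> excludes positive
    \<open>d\<close>.\<close>
  moreover have "2 * d = h \<theta>0 - h' \<theta>0"
    using \<theta>0 pos by (simp add: expected_add_on_eq field_simps)
  ultimately have "d \<le> 0"
    by simp
  with d[OF \<open>\<theta> \<in> \<Theta>\<close>] show ?thesis
    by simp
qed

text \<open>A rational type expects exactly the actual add-on, so the minimum that sets the price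
  cannot exceed it: the types that trade underestimate the add-on, at least weakly, and
  overpay.\<close>

lemma expected_buyer_payoff_nonpos:
  assumes "finite \<Theta>" "set_pmf \<mu> = \<Theta>" "\<Theta> = states n T" "finite \<M>" "{1..n} \<in> \<M>"
    and "interior_equilibrium \<Theta> \<mu> S v c \<M> h" "\<theta> \<in> \<Theta>"
  shows "expected_buyer_payoff S v c h \<theta> \<le> 0"
proof -
  let ?E = "\<lambda>M. \<Sum>\<theta>'\<in>\<Theta>. cond_prob \<Theta> \<mu> M \<theta> \<theta>' * expected_add_on S c h \<theta>'"
  have "Min (?E ` \<M>) \<le> ?E {1..n}"
    using assms by (intro Min_le) auto
  also have "\<dots> = expected_add_on S c h \<theta>"
    using assms by (intro cond_expectation_rational)
  finally show ?thesis
    using interior_equilibrium_price[OF assms(6,7)]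
    by (simp add: expected_buyer_payoff_def)
qed

theorem proposition3:
  fixes n :: nat
    and T :: "nat \<Rightarrow> 'a set"
    and \<Theta> :: "(nat \<Rightarrow> 'a) set"
    and \<mu> :: "(nat \<Rightarrow> 'a) pmf"
    and S :: "(nat \<Rightarrow> 'a) \<Rightarrow> real"
    and v c \<Delta> :: real
    and \<M> :: "nat set set"
    and M :: "nat set"
    and h h' :: "(nat \<Rightarrow> 'a) \<Rightarrow> real"
  assumes "\<Theta> = states n T"
    and "\<And>i. i \<in> {1..n} \<Longrightarrow> finite (T i)"
    and "set_pmf \<mu> = \<Theta>"
    and "\<And>\<theta>. \<theta> \<in> \<Theta> \<Longrightarrow> S \<theta> > 0"
    and "inj_on S \<Theta>"
    and "\<Delta> = v - c"
    and "\<Delta> > 0"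
    and "\<M> \<subseteq> Pow {1..n}"
    and "\<M> \<noteq> {}"
    and "M \<subseteq> {1..n}"
    and "M \<notin> \<M>"
    and "Max (S ` \<Theta>) - Min (S ` \<Theta>) < 2 * \<Delta>"
    and "2 * \<Delta> < Min (S ` \<Theta>)"
    and "interior_equilibrium \<Theta> \<mu> S v c \<M> h"
    and "interior_equilibrium \<Theta> \<mu> S v c (insert M \<M>) h'"
  shows "(\<forall>\<theta>\<in>\<Theta>. expected_add_on S c h' \<theta> \<le> expected_add_on S c h \<theta>) \<and>
    (\<forall>\<theta>\<in>\<Theta>. h \<theta> \<le> h' \<theta>) \<and>
    (\<forall>\<theta>\<in>\<Theta>. social_surplus S v c h \<theta> \<le> social_surplus S v c h' \<theta>) \<and>
    (\<forall>\<theta>\<in>\<Theta>. expected_buyer_payoff S v c h' \<theta> \<le> expected_buyer_payoff S v c h \<theta> \<and>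
       (\<forall>\<pi>\<in>{0..1}. buyer_payoff S v h' \<theta> \<pi> \<le> buyer_payoff S v h \<theta> \<pi>)) \<and>
    ({1..n} \<in> \<M> \<longrightarrow>
       0 \<le> ex_ante_consumer_loss \<Theta> \<mu> S v c h \<and>
       ex_ante_consumer_loss \<Theta> \<mu> S v c h \<le> ex_ante_consumer_loss \<Theta> \<mu> S v c h')"
proof -
  have fin: "finite \<Theta>"
    using assms(1,2) finite_states by blast
  have finM: "finite \<M>"
    using assms(8) by (rule finite_subset) simp
  have q: "expected_add_on S c h' \<theta> \<le> expected_add_on S c h \<theta>" if "\<theta> \<in> \<Theta>" for \<theta>
    using expected_add_on_antimono[OF fin assms(3,4) _ _ assms(9,14,15) that] finM by blast
  have h: "h \<theta> \<le> h' \<theta>" if "\<theta> \<in> \<Theta>" for \<theta>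
    using q[OF that] assms(4)[OF that] by (simp add: expected_add_on_eq)
  have vol: "trade_volume S c h \<theta> \<le> trade_volume S c h' \<theta>" if "\<theta> \<in> \<Theta>" for \<theta>
    using h[OF that] assms(4)[OF that]
    by (simp add: trade_volume_def marginal_type_def divide_right_mono)
  have surplus: "social_surplus S v c h \<theta> \<le> social_surplus S v c h' \<theta>" if "\<theta> \<in> \<Theta>" for \<theta>
    unfolding social_surplus_def using vol[OF that] assms(6,7) by (intro mult_left_mono) auto
  \<comment> \<open>The smaller expected add-on makes up for only half of the price rise, so the
    payoff falls by the other half.\<close>
  have payoff: "expected_buyer_payoff S v c h' \<theta> \<le> expected_buyer_payoff S v c h \<theta>"
    if "\<theta> \<in> \<Theta>" for \<theta>
    using q[OF that] assms(4)[OF that] h[OF that]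
    by (simp add: expected_buyer_payoff_def expected_add_on_eq field_simps)
  have "0 \<le> ex_ante_consumer_loss \<Theta> \<mu> S v c h \<and>
    ex_ante_consumer_loss \<Theta> \<mu> S v c h \<le> ex_ante_consumer_loss \<Theta> \<mu> S v c h'"
    if rational: "{1..n} \<in> \<M>"
  proof -
    have nonpos: "expected_buyer_payoff S v c h \<theta> \<le> 0" if "\<theta> \<in> \<Theta>" for \<theta>
      using expected_buyer_payoff_nonpos[OF fin assms(3,1) finM rational assms(14) that] .
    have vol0: "0 \<le> trade_volume S c h \<theta>" if "\<theta> \<in> \<Theta>" for \<theta>
      using interior_equilibrium_trade_volume_pos[OF assms(14) that] by simp
    \<comment> \<open>After negating payoffs, both volume and loss per trade are nonnegative and
      grow, hence so does their product. Without the sign from \<open>nonpos\<close>, more trade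
      could raise welfare.\<close>
    have welfare: "trade_volume S c h' \<theta> * expected_buyer_payoff S v c h' \<theta>
      \<le> trade_volume S c h \<theta> * expected_buyer_payoff S v c h \<theta>" if "\<theta> \<in> \<Theta>" for \<theta>
      using mult_mono[OF vol[OF that], of "- expected_buyer_payoff S v c h \<theta>"
          "- expected_buyer_payoff S v c h' \<theta>"] payoff[OF that] nonpos[OF that]
        vol0[OF that] vol[OF that]
      by simp
    show ?thesis
      unfolding ex_ante_consumer_loss_def
      using nonpos vol0 welfare
      by (auto intro!: sum_nonpos sum_mono mult_left_mono mult_nonneg_nonpos)
  qed
  \<comment> \<open>For a fixed firm type \<open>\<pi>\<close> the add-on is the same in both
    equilibria, so the individual payoff comparison reduces to the price comparison.\<close>
  then show ?thesis
    using q h surplus payoff by (simp add: buyer_payoff_def)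
qed

end
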